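(* Let $\varrho\in\mathcal{R}_p(1)$ and $v,d\ge0$. Then: (a) for every level-$d$ minterm $\mu$ (in $v$ variables), $\mu*\varrho$ is $\approx$ to a single level-$d$ minterm, and the map $f_\varrho(\mu)=\mu*\varrho$ is a bijection of the set of level-$d$ minterms; (b) for every prime orbit $\omega$ of level-$d$ minterms, $\omega*\varrho:=\{\mu*\varrho:\mu\in\omega\}$ is a prime orbit, and the map $\omega\mapsto\omega*\varrho$ is a bijection of the set of prime orbits.
   Context: Language: variables $p_1,p_2,\dots$, constants $0,1$, connectives $\neg,\vee,\wedge$, modal operator $\lozenge$. $\mathbf{E}$ is the smallest set of formulas containing all tautologies and closed under modus ponens, uniform substitution and RE (from $\varphi\leftrightarrow\psi$ infer $\lozenge\varphi\leftrightarrow\lozenge\psi$). $\varphi\approx\psi$ means $\vdash_{\mathbf{E}}\varphi\leftrightarrow\psi$. $\mathcal{F}(v,d)$: formulas in $p_1,\dots,p_v$ of $\lozenge$-depth $\le d$. DCF minterms (fixed $v$): level-0 minterms are $\pm p_1\wedge\dots\wedge\pm p_v$; DCF formulas of $\mathcal{F}(v,0)$ are disjunctions of sets of distinct level-0 minterms; for $d\ge1$ the level-$d$ modal factors are $\lozenge\phi$ for every DCF formula $\phi$ of $\mathcal{F}(v,d-1)$, a level-$d$ minterm is a level-0 minterm conjoined with every level-$d$ modal factor, each plain or negated, and DCF formulas of $\mathcal{F}(v,d)$ are disjunctions of sets of distinct level-$d$ minterms. Every formula of $\mathcal{F}(v,d)$ is $\approx$ to a unique DCF formula. Prime orbits: a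 level-0 substitution is a tuple $\sigma=(\sigma_1,\dots,\sigma_v)$ of non-modal formulas in $p_1,\dots,p_v$ (up to $\approx$), acting by $\varphi\mapsto\varphi\circ\sigma$ (replace each $p_i$ by $\sigma_i$); under composition $(\sigma\sigma')_i=\sigma_i(\sigma'_1,\dots,\sigma'_v)$ they form a monoid whose invertible elements form the group $\mathcal{S}_p(v,0)$ of prime substitutions. For prime $\varsigma$, $\mu\circ\varsigma$ is $\approx$ to a single level-$d$ minterm; the orbits of the resulting action on level-$d$ minterms are the prime orbits. Uniform replacements: a UR is a formula $\rho(e)$ of modal degree $\le1$ in one variable $e$; $\varphi*\rho$ is defined recursively by $0*\rho=0$, $1*\rho=1$, $p_i*\rho=p_i$, $(\psi\vee\theta)*\rho=(\psi*\rho)\vee(\theta*\rho)$, $(\neg\psi)*\rho=\neg(\psi*\rho)$, $(\lozenge\psi)*\rho=\rho(\psi*\rho)$ (substitute $\psi*\rho$ for $e$). $\mathcal{R}_p(1)$ is the set of 24 URs: $\lambda\leftrightarrow\tau$ with $\lambda\in\{\lozenge e,\neg\lozenge e\}$, $\tau\in\{1,e,e\vee\lozenge\neg e,e\vee\neg\lozenge\neg e,\neg e\vee\lozenge\neg e,\neg e\vee\neg\lozenge\neg e\}$, and $\lambda\leftrightarrow\tau$ with $\lambda\in\{\lozenge\neg e,\neg\lozenge\neg e\}$, $\tau\in\{1,e,e\vee\lozenge e,e\vee\neg\lozenge e,\neg e\vee\lozenge e,\neg e\vee\neg\lozenge e\}$. *)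

theory Defs
  imports Main
begin

(* The variables p_1, p_2, ... are Var 0, Var 1, ... *)
datatype fm =
    Var nat | Bot | Top | Neg fm | Or fm fm | And fm fm | Dia fm

abbreviation Imp :: "fm \<Rightarrow> fm \<Rightarrow> fm" where
  "Imp \<phi> \<psi> \<equiv> Or (Neg \<phi>) \<psi>"

abbreviation Iff :: "fm \<Rightarrow> fm \<Rightarrow> fm" where
  "Iff \<phi> \<psi> \<equiv> And (Imp \<phi> \<psi>) (Imp \<psi> \<phi>)"

primrec fm_vars :: "fm \<Rightarrow> nat set" where
  "fm_vars (Var i) = {i}"
| "fm_vars Bot = {}"
| "fm_vars Top = {}"
| "fm_vars (Neg \<phi>) = fm_vars \<phi>"
| "fm_vars (Or \<phi> \<psi>) = fm_vars \<phi> \<union> fm_vars \<psi>"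
| "fm_vars (And \<phi> \<psi>) = fm_vars \<phi> \<union> fm_vars \<psi>"
| "fm_vars (Dia \<phi>) = fm_vars \<phi>"

primrec fm_depth :: "fm \<Rightarrow> nat" where
  "fm_depth (Var i) = 0"
| "fm_depth Bot = 0"
| "fm_depth Top = 0"
| "fm_depth (Neg \<phi>) = fm_depth \<phi>"
| "fm_depth (Or \<phi> \<psi>) = max (fm_depth \<phi>) (fm_depth \<psi>)"
| "fm_depth (And \<phi> \<psi>) = max (fm_depth \<phi>) (fm_depth \<psi>)"
| "fm_depth (Dia \<phi>) = Suc (fm_depth \<phi>)"

definition formulas :: "nat \<Rightarrow> nat \<Rightarrow> fm set" where
  "formulas v d = {\<phi>. fm_vars \<phi> \<subseteq> {..<v} \<and> fm_depth \<phi> \<le> d}"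

primrec fm_subst :: "(nat \<Rightarrow> fm) \<Rightarrow> fm \<Rightarrow> fm" where
  "fm_subst \<sigma> (Var i) = \<sigma> i"
| "fm_subst \<sigma> Bot = Bot"
| "fm_subst \<sigma> Top = Top"
| "fm_subst \<sigma> (Neg \<phi>) = Neg (fm_subst \<sigma> \<phi>)"
| "fm_subst \<sigma> (Or \<phi> \<psi>) = Or (fm_subst \<sigma> \<phi>) (fm_subst \<sigma> \<psi>)"
| "fm_subst \<sigma> (And \<phi> \<psi>) = And (fm_subst \<sigma> \<phi>) (fm_subst \<sigma> \<psi>)"
| "fm_subst \<sigma> (Dia \<phi>) = Dia (fm_subst \<sigma> \<phi>)"

(* Boolean evaluation that treats variables and formulas Dia \<phi> as atoms. *)
primrec bool_eval :: "(fm \<Rightarrow> bool) \<Rightarrow> fm \<Rightarrow> bool" where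
  "bool_eval V (Var i) = V (Var i)"
| "bool_eval V Bot = False"
| "bool_eval V Top = True"
| "bool_eval V (Neg \<phi>) = (\<not> bool_eval V \<phi>)"
| "bool_eval V (Or \<phi> \<psi>) = (bool_eval V \<phi> \<or> bool_eval V \<psi>)"
| "bool_eval V (And \<phi> \<psi>) = (bool_eval V \<phi> \<and> bool_eval V \<psi>)"
| "bool_eval V (Dia \<phi>) = V (Dia \<phi>)"

definition tautology :: "fm \<Rightarrow> bool" where
  "tautology \<phi> \<longleftrightarrow> (\<forall>V. bool_eval V \<phi>)"

inductive logic_E :: "fm \<Rightarrow> bool" where
  Taut: "tautology \<phi> \<Longrightarrow> logic_E \<phi>"
| MP: "logic_E \<phi> \<Longrightarrow> logic_E (Imp \<phi> \<psi>) \<Longrightarrow> logic_E \<psi>"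
| US: "logic_E \<phi> \<Longrightarrow> logic_E (fm_subst \<sigma> \<phi>)"
| RE: "logic_E (Iff \<phi> \<psi>) \<Longrightarrow> logic_E (Iff (Dia \<phi>) (Dia \<psi>))"

definition equiv_E :: "fm \<Rightarrow> fm \<Rightarrow> bool"  (infix "\<approx>" 50) where
  "\<phi> \<approx> \<psi> \<longleftrightarrow> logic_E (Iff \<phi> \<psi>)"

fun conj_list :: "fm list \<Rightarrow> fm" where
  "conj_list [] = Top"
| "conj_list [\<phi>] = \<phi>"
| "conj_list (\<phi> # \<psi> # \<phi>s) = And \<phi> (conj_list (\<psi> # \<phi>s))"

fun disj_list :: "fm list \<Rightarrow> fm" where
  "disj_list [] = Bot"
| "disj_list [\<phi>] = \<phi>"
| "disj_list (\<phi> # \<psi> # \<phi>s) = Or \<phi> (disj_list (\<psi> # \<phi>s))"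

definition signed_conjs :: "fm list \<Rightarrow> fm list" where
  "signed_conjs \<phi>s = map conj_list (product_lists (map (\<lambda>\<phi>. [\<phi>, Neg \<phi>]) \<phi>s))"

(* The minterms of each level are listed in a fixed order, and a set of minterms is
   disjoined in that order (as a subsequence of the list), so that every DCF formula is
   one definite formula. *)
definition set_disjs :: "fm list \<Rightarrow> fm list" where
  "set_disjs \<phi>s = map disj_list (subseqs \<phi>s)"

fun minterm_list :: "nat \<Rightarrow> nat \<Rightarrow> fm list" where
  "minterm_list v 0 = signed_conjs (map Var [0..<v])"
| "minterm_list v (Suc d) =
     [And \<mu> \<chi>. \<mu> \<leftarrow> minterm_list v 0,
               \<chi> \<leftarrow> signed_conjs (map Dia (set_disjs (minterm_list v d)))]"

definition minterms :: "nat \<Rightarrow> nat \<Rightarrow> fm set" where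
  "minterms v d = set (minterm_list v d)"

definition minterm_of :: "nat \<Rightarrow> nat \<Rightarrow> fm \<Rightarrow> fm" where
  "minterm_of v d \<phi> = (THE \<nu>. \<nu> \<in> minterms v d \<and> \<phi> \<approx> \<nu>)"

(* A v-tuple of formulas is a function of which only the values at i < v matter. *)
definition level0_substs :: "nat \<Rightarrow> (nat \<Rightarrow> fm) set" where
  "level0_substs v = {\<sigma>. \<forall>i<v. \<sigma> i \<in> formulas v 0}"

definition subst_comp :: "(nat \<Rightarrow> fm) \<Rightarrow> (nat \<Rightarrow> fm) \<Rightarrow> nat \<Rightarrow> fm" where
  "subst_comp \<sigma> \<sigma>' = (\<lambda>i. fm_subst \<sigma>' (\<sigma> i))"

definition subst_equiv :: "nat \<Rightarrow> (nat \<Rightarrow> fm) \<Rightarrow> (nat \<Rightarrow> fm) \<Rightarrow> bool" where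
  "subst_equiv v \<sigma> \<sigma>' \<longleftrightarrow> (\<forall>i<v. \<sigma> i \<approx> \<sigma>' i)"

definition prime_substs :: "nat \<Rightarrow> (nat \<Rightarrow> fm) set" where
  "prime_substs v = {\<sigma> \<in> level0_substs v. \<exists>\<sigma>' \<in> level0_substs v.
     subst_equiv v (subst_comp \<sigma> \<sigma>') Var \<and> subst_equiv v (subst_comp \<sigma>' \<sigma>) Var}"

definition prime_orbit :: "nat \<Rightarrow> nat \<Rightarrow> fm \<Rightarrow> fm set" where
  "prime_orbit v d \<mu> = (\<lambda>\<sigma>. minterm_of v d (fm_subst \<sigma> \<mu>)) ` prime_substs v"

definition prime_orbits :: "nat \<Rightarrow> nat \<Rightarrow> fm set set" where
  "prime_orbits v d = prime_orbit v d ` minterms v d"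

(* A uniform replacement is a formula whose only variable is e, so substituting for e
   is substituting for every variable. *)
abbreviation (input) e_var :: fm where
  "e_var \<equiv> Var 0"

primrec replace :: "fm \<Rightarrow> fm \<Rightarrow> fm"  (infixl "\<star>" 75) where
  "Var i \<star> \<rho> = Var i"
| "Bot \<star> \<rho> = Bot"
| "Top \<star> \<rho> = Top"
| "Neg \<psi> \<star> \<rho> = Neg (\<psi> \<star> \<rho>)"
| "Or \<psi> \<theta> \<star> \<rho> = Or (\<psi> \<star> \<rho>) (\<theta> \<star> \<rho>)"
| "And \<psi> \<theta> \<star> \<rho> = And (\<psi> \<star> \<rho>) (\<theta> \<star> \<rho>)"
| "Dia \<psi> \<star> \<rho> = fm_subst (\<lambda>_. \<psi> \<star> \<rho>) \<rho>"

definition prime_URs :: "fm set" where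
  "prime_URs =
     {Iff l t | l t.
        l \<in> {Dia e_var, Neg (Dia e_var)} \<and>
        t \<in> {Top, e_var,
             Or e_var (Dia (Neg e_var)), Or e_var (Neg (Dia (Neg e_var))),
             Or (Neg e_var) (Dia (Neg e_var)), Or (Neg e_var) (Neg (Dia (Neg e_var)))}} \<union>
     {Iff l t | l t.
        l \<in> {Dia (Neg e_var), Neg (Dia (Neg e_var))} \<and>
        t \<in> {Top, e_var,
             Or e_var (Dia e_var), Or e_var (Neg (Dia e_var)),
             Or (Neg e_var) (Dia e_var), Or (Neg e_var) (Neg (Dia e_var))}}"

definition minterm_map :: "nat \<Rightarrow> nat \<Rightarrow> fm \<Rightarrow> fm \<Rightarrow> fm" where
  "minterm_map v d \<rho> \<mu> = minterm_of v d (\<mu> \<star> \<rho>)"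

definition orbit_map :: "nat \<Rightarrow> nat \<Rightarrow> fm \<Rightarrow> fm set \<Rightarrow> fm set" where
  "orbit_map v d \<rho> \<omega> = minterm_map v d \<rho> ` \<omega>"

end

theory Submission imports Defs begin

text \<open>
  Call a Boolean valuation of the atoms an E-valuation if it gives \<open>Dia \<phi>\<close> and \<open>Dia \<psi>\<close> the same
  value whenever \<open>\<phi> \<approx> \<psi>\<close>; a formula is a theorem of E iff all E-valuations satisfy it. Every
  E-valuation satisfies exactly one level-\<open>d\<close> minterm, every minterm is satisfied by some
  E-valuation, and the minterm satisfied decides all formulas of modal depth at most \<open>d\<close>: the
  minterms are the atoms of the finite Boolean algebra of these formulas modulo \<open>\<approx>\<close>. Hence every
  Boolean endomorphism that is invertible up to \<open>\<approx>\<close> permutes them.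

  Prime substitutions are invertible by definition. A prime uniform replacement \<open>\<rho>\<close> acts, where
  \<open>e\<close> holds, on the pair of truth values of \<open>(Dia e, Dia (Neg e))\<close> by a permutation of the four
  pairs. Elements of the symmetric group on four points have order dividing 12, so the twelfth
  iterate of \<open>\<phi> \<mapsto> \<phi> \<star> \<rho>\<close> is the identity up to \<open>\<approx>\<close>. Finally, this map commutes with non-modal
  substitutions, and therefore permutes their orbits.
\<close>

section \<open>E-valuations\<close>

text \<open>The premises are discharged one at a time: the induction hypothesis makes
  \<open>Imp \<gamma> \<phi>\<close> a theorem, and modus ponens removes \<gamma>.\<close>

lemma logic_E_tautological_consequence:
  assumes "finite \<Gamma>" "\<forall>\<gamma>\<in>\<Gamma>. logic_E \<gamma>"
    and "\<And>V. \<forall>\<gamma>\<in>\<Gamma>. bool_eval V \<gamma> \<Longrightarrow> bool_eval V \<phi>"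
  shows "logic_E \<phi>"
  using assms
proof (induction \<Gamma> arbitrary: \<phi> rule: finite_induct)
  case empty
  then show ?case by (auto intro: logic_E.Taut simp: tautology_def)
next
  case (insert \<gamma> \<Gamma>)
  have "logic_E (Imp \<gamma> \<phi>)"
    using insert.prems by (intro insert.IH) auto
  then show ?case
    using insert.prems by (auto intro: logic_E.MP)
qed

lemma bool_eval_Iff: "bool_eval V (Iff \<phi> \<psi>) \<longleftrightarrow> bool_eval V \<phi> = bool_eval V \<psi>"
  by auto

lemma equiv_E_refl [simp]: "\<phi> \<approx> \<phi>"
  unfolding equiv_E_def by (rule logic_E.Taut) (simp add: tautology_def)

lemma equiv_E_sym: "\<phi> \<approx> \<psi> \<Longrightarrow> \<psi> \<approx> \<phi>"
  unfolding equiv_E_def by (rule logic_E_tautological_consequence[of "{Iff \<phi> \<psi>}"]) auto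

lemma equiv_E_trans: "\<phi> \<approx> \<psi> \<Longrightarrow> \<psi> \<approx> \<chi> \<Longrightarrow> \<phi> \<approx> \<chi>"
  unfolding equiv_E_def
  by (rule logic_E_tautological_consequence[of "{Iff \<phi> \<psi>, Iff \<psi> \<chi>}"])
    (simp_all add: bool_eval_Iff del: bool_eval.simps)

definition E_valuation :: "(fm \<Rightarrow> bool) \<Rightarrow> bool" where
  "E_valuation V \<longleftrightarrow> (\<forall>\<phi> \<psi>. \<phi> \<approx> \<psi> \<longrightarrow> V (Dia \<phi>) = V (Dia \<psi>))"

lemma bool_eval_subst:
  "bool_eval V (fm_subst \<sigma> \<phi>) = bool_eval (\<lambda>\<alpha>. bool_eval V (fm_subst \<sigma> \<alpha>)) \<phi>"
  by (induction \<phi>) auto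

lemma equiv_E_subst: "\<phi> \<approx> \<psi> \<Longrightarrow> fm_subst \<sigma> \<phi> \<approx> fm_subst \<sigma> \<psi>"
  using logic_E.US[of "Iff \<phi> \<psi>" \<sigma>] by (simp add: equiv_E_def)

text \<open>In the case \<open>US\<close> the hypothesis is applied to the valuation pulled back
  along the substitution, hence the induction over arbitrary \<open>V\<close>. The pulled-back
  valuation respects \<approx> because \<approx> is closed under substitution.\<close>

lemma logic_E_sound: "logic_E \<phi> \<Longrightarrow> E_valuation V \<Longrightarrow> bool_eval V \<phi>"
proof (induction arbitrary: V rule: logic_E.induct)
  case (US \<phi> \<sigma>)
  have "E_valuation (\<lambda>\<alpha>. bool_eval V (fm_subst \<sigma> \<alpha>))"
    using US.prems by (auto simp: E_valuation_def dest: equiv_E_subst)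
  then show ?case
    using US.IH bool_eval_subst by blast
next
  case (RE \<phi> \<psi>)
  then have "V (Dia \<phi>) = V (Dia \<psi>)"
    by (simp add: E_valuation_def equiv_E_def)
  then show ?case by simp
qed (auto simp: tautology_def)

text \<open>Only the outermost diamonds are collected: these are the modal atoms on which
  \<open>bool_eval\<close> depends.\<close>

primrec dia_atoms :: "fm \<Rightarrow> fm set" where
  "dia_atoms (Var i) = {}"
| "dia_atoms Bot = {}"
| "dia_atoms Top = {}"
| "dia_atoms (Neg \<phi>) = dia_atoms \<phi>"
| "dia_atoms (Or \<phi> \<psi>) = dia_atoms \<phi> \<union> dia_atoms \<psi>"
| "dia_atoms (And \<phi> \<psi>) = dia_atoms \<phi> \<union> dia_atoms \<psi>"
| "dia_atoms (Dia \<phi>) = {\<phi>}"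

lemma finite_dia_atoms [simp]: "finite (dia_atoms \<phi>)"
  by (induction \<phi>) auto

lemma bool_eval_cong:
  "(\<And>i. V (Var i) = W (Var i)) \<Longrightarrow> (\<And>\<alpha>. \<alpha> \<in> dia_atoms \<phi> \<Longrightarrow> V (Dia \<alpha>) = W (Dia \<alpha>)) \<Longrightarrow>
    bool_eval V \<phi> = bool_eval W \<phi>"
  by (induction \<phi>) auto

text \<open>
  The E-valuation with prescribed values on the variables and on \<open>Dia \<alpha>\<close> for \<open>\<alpha>\<close> in a set \<open>S\<close>;
  it has the prescribed values if these respect \<open>\<approx>\<close> on \<open>S\<close>.
\<close>
definition E_extension :: "fm set \<Rightarrow> (fm \<Rightarrow> bool) \<Rightarrow> fm \<Rightarrow> bool" where
  "E_extension S V \<phi> = (case \<phi> of Dia \<alpha> \<Rightarrow> \<exists>\<beta>\<in>S. \<beta> \<approx> \<alpha> \<and> V (Dia \<beta>) | _ \<Rightarrow> V \<phi>)"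

lemma E_extension_simps [simp]:
  "E_extension S V (Var i) = V (Var i)"
  "E_extension S V (Dia \<alpha>) \<longleftrightarrow> (\<exists>\<beta>\<in>S. \<beta> \<approx> \<alpha> \<and> V (Dia \<beta>))"
  by (simp_all add: E_extension_def)

lemma E_valuation_extension: "E_valuation (E_extension S V)"
  by (auto simp: E_valuation_def intro: equiv_E_trans equiv_E_sym)

text \<open>Finitely many instances of \<open>RE\<close> suffice, those relating equivalent modal
  atoms of \<phi>: a valuation satisfying them agrees on \<phi> with an E-valuation. Hence \<phi> is
  a tautological consequence of theorems.\<close>

lemma logic_E_complete:
  assumes "\<And>V. E_valuation V \<Longrightarrow> bool_eval V \<phi>"
  shows "logic_E \<phi>"
proof (rule logic_E_tautological_consequence)
  let ?S = "dia_atoms \<phi>"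
  let ?\<Gamma> = "(\<lambda>(\<alpha>, \<beta>). Iff (Dia \<alpha>) (Dia \<beta>)) ` {(\<alpha>, \<beta>) \<in> ?S \<times> ?S. \<alpha> \<approx> \<beta>}"
  show "finite ?\<Gamma>"
    by (rule finite_imageI, rule finite_subset[of _ "?S \<times> ?S"]) auto
  show "\<forall>\<gamma>\<in>?\<Gamma>. logic_E \<gamma>"
    by (auto simp: equiv_E_def intro: logic_E.RE)
  fix V assume V: "\<forall>\<gamma>\<in>?\<Gamma>. bool_eval V \<gamma>"
  have "V (Dia \<alpha>) = V (Dia \<beta>)" if "\<alpha> \<in> ?S" "\<beta> \<in> ?S" "\<alpha> \<approx> \<beta>" for \<alpha> \<beta>
  proof -
    have "Iff (Dia \<alpha>) (Dia \<beta>) \<in> ?\<Gamma>"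
      using that by (auto simp: image_iff)
    then have "bool_eval V (Iff (Dia \<alpha>) (Dia \<beta>))"
      using V by blast
    then show ?thesis by auto
  qed
  then have "E_extension ?S V (Dia \<alpha>) = V (Dia \<alpha>)" if "\<alpha> \<in> ?S" for \<alpha>
    using that equiv_E_refl unfolding E_extension_simps by metis
  then have "bool_eval (E_extension ?S V) \<phi> = bool_eval V \<phi>"
    by (intro bool_eval_cong) simp_all
  then show "bool_eval V \<phi>"
    using assms E_valuation_extension by blast
qed

lemma equiv_E_iff:
  "\<phi> \<approx> \<psi> \<longleftrightarrow> (\<forall>V. E_valuation V \<longrightarrow> bool_eval V \<phi> = bool_eval V \<psi>)"
proof
  assume "\<phi> \<approx> \<psi>"
  then show "\<forall>V. E_valuation V \<longrightarrow> bool_eval V \<phi> = bool_eval V \<psi>"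
    using logic_E_sound[of "Iff \<phi> \<psi>"] by (auto simp: equiv_E_def)
next
  assume "\<forall>V. E_valuation V \<longrightarrow> bool_eval V \<phi> = bool_eval V \<psi>"
  then show "\<phi> \<approx> \<psi>"
    unfolding equiv_E_def by (intro logic_E_complete) auto
qed

lemma equiv_E_Dia: "\<phi> \<approx> \<psi> \<Longrightarrow> Dia \<phi> \<approx> Dia \<psi>"
  by (simp add: equiv_E_def logic_E.RE)

lemma fm_subst_cong_equiv_E:
  "(\<And>i. i \<in> fm_vars \<phi> \<Longrightarrow> \<sigma> i \<approx> \<tau> i) \<Longrightarrow> fm_subst \<sigma> \<phi> \<approx> fm_subst \<tau> \<phi>"
proof (induction \<phi>)
  case (Dia \<phi>)
  then show ?case by (auto intro: equiv_E_Dia)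
qed (auto simp: equiv_E_iff)

section \<open>Minterms as atoms\<close>

lemma bool_eval_conj_list [simp]:
  "bool_eval V (conj_list \<phi>s) \<longleftrightarrow> (\<forall>\<phi>\<in>set \<phi>s. bool_eval V \<phi>)"
  by (induction \<phi>s rule: conj_list.induct) auto

lemma bool_eval_disj_list [simp]:
  "bool_eval V (disj_list \<phi>s) \<longleftrightarrow> (\<exists>\<phi>\<in>set \<phi>s. bool_eval V \<phi>)"
  by (induction \<phi>s rule: disj_list.induct) auto

lemma conj_list_formulas: "set \<phi>s \<subseteq> formulas v d \<Longrightarrow> conj_list \<phi>s \<in> formulas v d"
  by (induction \<phi>s rule: conj_list.induct) (auto simp: formulas_def)

lemma disj_list_formulas: "set \<phi>s \<subseteq> formulas v d \<Longrightarrow> disj_list \<phi>s \<in> formulas v d"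
  by (induction \<phi>s rule: disj_list.induct) (auto simp: formulas_def)

text \<open>Equal lengths exclude pairs such as \<open>[And \<phi> \<psi>]\<close> and
  \<open>[\<phi>, \<psi>]\<close>, whose conjunctions coincide.\<close>

lemma conj_list_inject:
  "length \<phi>s = length \<psi>s \<Longrightarrow> conj_list \<phi>s = conj_list \<psi>s \<longleftrightarrow> \<phi>s = \<psi>s"
proof (induction \<phi>s \<psi>s rule: list_induct2)
  case (Cons \<phi> \<phi>s \<psi> \<psi>s)
  then show ?case by (cases \<phi>s; cases \<psi>s) auto
qed simp

definition literal :: "(fm \<Rightarrow> bool) \<Rightarrow> fm \<Rightarrow> fm" where
  "literal P \<phi> = (if P \<phi> then \<phi> else Neg \<phi>)"

lemma Neg_neq [simp]: "Neg \<phi> \<noteq> \<phi>" "\<phi> \<noteq> Neg \<phi>"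
  by (induction \<phi>) auto

lemma bool_eval_literal [simp]: "bool_eval V (literal P \<phi>) \<longleftrightarrow> bool_eval V \<phi> = P \<phi>"
  by (simp add: literal_def)

lemma set_signed_conjs:
  "set (signed_conjs \<phi>s) = conj_list ` {xs. list_all2 (\<lambda>x \<phi>. x = \<phi> \<or> x = Neg \<phi>) xs \<phi>s}"
  by (simp add: signed_conjs_def product_lists_set list_all2_map2)

lemma literals_in_signed_conjs: "conj_list (map (literal P) \<phi>s) \<in> set (signed_conjs \<phi>s)"
  by (auto simp: set_signed_conjs literal_def list_all2_map1 list_all2_same intro!: imageI)

lemma signed_conjs_distinct_literals:
  assumes "distinct \<phi>s" "\<chi> \<in> set (signed_conjs \<phi>s)"
  obtains P where "\<chi> = conj_list (map (literal P) \<phi>s)"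
proof -
  obtain xs where xs: "\<chi> = conj_list xs" "list_all2 (\<lambda>x \<phi>. x = \<phi> \<or> x = Neg \<phi>) xs \<phi>s"
    using assms(2) by (auto simp: set_signed_conjs)
  \<comment> \<open>\<open>P\<close> reads off the sign at the position of \<phi>; distinctness
    makes this position unique.\<close>
  define P where "P \<phi> \<longleftrightarrow> (\<exists>i<length \<phi>s. \<phi> = \<phi>s ! i \<and> xs ! i = \<phi>s ! i)" for \<phi>
  have "P (\<phi>s ! i) \<longleftrightarrow> xs ! i = \<phi>s ! i" if "i < length \<phi>s" for i
    using that assms(1) by (auto simp: P_def nth_eq_iff_index_eq)
  then have "xs = map (literal P) \<phi>s"
    using xs(2) by (intro nth_equalityI) (auto simp: list_all2_conv_all_nth literal_def)
  then show thesis
    using that xs(1) by blast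
qed

text \<open>Of \<phi> and \<open>Neg \<phi>\<close> only one is true under \<open>V\<close>, so a
  satisfying valuation forces every sign.\<close>

lemma signed_conjs_satisfied:
  assumes "\<chi> \<in> set (signed_conjs \<phi>s)" "bool_eval V \<chi>"
  shows "\<chi> = conj_list (map (literal (bool_eval V)) \<phi>s)"
proof -
  obtain xs where xs: "\<chi> = conj_list xs" "list_all2 (\<lambda>x \<phi>. x = \<phi> \<or> x = Neg \<phi>) xs \<phi>s"
    using assms(1) by (auto simp: set_signed_conjs)
  have "xs ! i = literal (bool_eval V) (\<phi>s ! i)" if "i < length \<phi>s" for i
  proof -
    have "bool_eval V (xs ! i)" "xs ! i = \<phi>s ! i \<or> xs ! i = Neg (\<phi>s ! i)"
      using that xs assms(2) by (auto simp: list_all2_conv_all_nth)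
    then show ?thesis by (auto simp: literal_def)
  qed
  then have "xs = map (literal (bool_eval V)) \<phi>s"
    using xs(2) by (intro nth_equalityI) (auto simp: list_all2_conv_all_nth)
  with xs(1) show ?thesis by simp
qed

lemma signed_conjs_agree:
  assumes "\<chi> \<in> set (signed_conjs \<phi>s)" "bool_eval V \<chi>" "bool_eval W \<chi>" "\<phi> \<in> set \<phi>s"
  shows "bool_eval V \<phi> = bool_eval W \<phi>"
proof -
  have "bool_eval W (conj_list (map (literal (bool_eval V)) \<phi>s))"
    using assms(3) signed_conjs_satisfied[OF assms(1,2)] by simp
  then show ?thesis
    using assms(4) by auto
qed

lemma signed_conjs_formulas:
  assumes "set \<phi>s \<subseteq> formulas v d"
  shows "set (signed_conjs \<phi>s) \<subseteq> formulas v d"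
proof
  fix \<chi> assume "\<chi> \<in> set (signed_conjs \<phi>s)"
  then obtain xs where xs: "\<chi> = conj_list xs" "list_all2 (\<lambda>x \<phi>. x = \<phi> \<or> x = Neg \<phi>) xs \<phi>s"
    by (auto simp: set_signed_conjs)
  have "x \<in> formulas v d" if "x \<in> set xs" for x
  proof -
    obtain i where "i < length xs" "x = xs ! i"
      using \<open>x \<in> set xs\<close> by (auto simp: in_set_conv_nth)
    then have "x = \<phi>s ! i \<or> x = Neg (\<phi>s ! i)" "\<phi>s ! i \<in> formulas v d"
      using xs(2) assms by (auto simp: list_all2_conv_all_nth)
    then show ?thesis by (auto simp: formulas_def)
  qed
  then show "\<chi> \<in> formulas v d"
    using xs(1) conj_list_formulas by blast
qed

lemma distinct_signed_conjs: "distinct (signed_conjs \<phi>s)"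
proof -
  have "inj_on conj_list (set (product_lists (map (\<lambda>\<phi>. [\<phi>, Neg \<phi>]) \<phi>s)))"
    by (intro inj_onI) (metis conj_list_inject in_set_product_lists_length)
  then show ?thesis
    by (auto simp: signed_conjs_def distinct_map intro!: distinct_product_lists)
qed

section \<open>Lists of minterms and of DCF formulas\<close>

abbreviation dcf_list :: "nat \<Rightarrow> nat \<Rightarrow> fm list" where
  "dcf_list v d \<equiv> set_disjs (minterm_list v d)"

declare minterm_list.simps(2) [simp del]

lemma minterm_list_Suc:
  "minterm_list v (Suc d) = map (\<lambda>(\<mu>, \<chi>). And \<mu> \<chi>)
     (List.product (minterm_list v 0) (signed_conjs (map Dia (dcf_list v d))))"
  by (simp add: minterm_list.simps(2) product_concat_map map_concat comp_def)

lemma minterms_Suc: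
  "minterms v (Suc d) = {And \<mu> \<chi> | \<mu> \<chi>.
     \<mu> \<in> minterms v 0 \<and> \<chi> \<in> set (signed_conjs (map Dia (dcf_list v d)))}"
  by (auto simp: minterms_def minterm_list_Suc simp del: minterm_list.simps)

lemma minterms_0: "minterms v 0 = set (signed_conjs (map Var [0..<v]))"
  by (simp add: minterms_def)

text \<open>Distinctness makes a subsequence of the list recoverable from its set of
  minterms.\<close>

lemma distinct_minterm_list: "distinct (minterm_list v d)"
proof (cases d)
  case 0
  then show ?thesis by (simp add: distinct_signed_conjs)
next
  case (Suc d')
  then show ?thesis
    by (auto simp: minterm_list_Suc distinct_map distinct_signed_conjs inj_on_def
        intro!: distinct_product)
qed

lemma set_dcf_list: "set (dcf_list v d) = disj_list ` set (subseqs (minterm_list v d))"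
  by (simp add: set_disjs_def)

lemma subseqs_minterm_subset: "xs \<in> set (subseqs (minterm_list v d)) \<Longrightarrow> set xs \<subseteq> minterms v d"
  using subseqs_powset[of "minterm_list v d"] by (auto simp: minterms_def)

lemma minterms_subset_formulas: "minterms v d \<subseteq> formulas v d"
proof (induction d)
  case 0
  show ?case
    unfolding minterms_0 by (rule signed_conjs_formulas) (auto simp: formulas_def)
next
  case (Suc d)
  have "set (dcf_list v d) \<subseteq> formulas v d"
    using Suc subseqs_minterm_subset by (force simp: set_dcf_list intro!: disj_list_formulas)
  then have "set (map Dia (dcf_list v d)) \<subseteq> formulas v (Suc d)"
    by (fastforce simp: formulas_def)
  then have "set (signed_conjs (map Dia (dcf_list v d))) \<subseteq> formulas v (Suc d)"
    by (rule signed_conjs_formulas)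
  moreover have "minterms v 0 \<subseteq> formulas v (Suc d)"
  proof -
    have "minterms v 0 \<subseteq> formulas v 0"
      unfolding minterms_0 by (rule signed_conjs_formulas) (auto simp: formulas_def)
    then show ?thesis by (auto simp: formulas_def)
  qed
  ultimately show ?case
    by (fastforce simp: minterms_Suc formulas_def)
qed

section \<open>Satisfaction of minterms\<close>

lemma ex_minterm_satisfied: "\<exists>\<mu>\<in>minterms v d. bool_eval V \<mu>"
proof -
  have conj: "\<exists>\<chi>\<in>set (signed_conjs \<phi>s). bool_eval V \<chi>" for \<phi>s
    by (rule bexI[OF _ literals_in_signed_conjs[of "bool_eval V"]]) simp
  show ?thesis
  proof (cases d)
    case 0
    then show ?thesis using conj by (simp add: minterms_0)
  next
    case (Suc d')
    obtain \<mu> \<chi> where "\<mu> \<in> minterms v 0" "bool_eval V \<mu>"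
      "\<chi> \<in> set (signed_conjs (map Dia (dcf_list v d')))" "bool_eval V \<chi>"
      using conj by (metis minterms_0)
    then show ?thesis
      unfolding Suc minterms_Suc by (intro bexI[of _ "And \<mu> \<chi>"]) auto
  qed
qed

lemma satisfied_minterm_unique:
  assumes "\<mu> \<in> minterms v d" "\<nu> \<in> minterms v d" "bool_eval V \<mu>" "bool_eval V \<nu>"
  shows "\<mu> = \<nu>"
proof -
  have conj: "\<chi> = \<chi>'" if "\<chi> \<in> set (signed_conjs \<phi>s)" "\<chi>' \<in> set (signed_conjs \<phi>s)"
    "bool_eval V \<chi>" "bool_eval V \<chi>'" for \<chi> \<chi>' \<phi>s
    using that signed_conjs_satisfied by metis
  show ?thesis
    using assms by (cases d) (auto simp: minterms_0 minterms_Suc dest: conj)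
qed

text \<open>A valuation satisfying a minterm of \<open>xs\<close> satisfies one of
  \<open>ys\<close>, and the two coincide because no valuation satisfies two minterms.
  Satisfiability is a hypothesis because its own inductive proof uses this result one level
  below.\<close>

lemma equivalent_disjunctions_eq:
  assumes sat: "\<And>\<mu>. \<mu> \<in> minterms v d \<Longrightarrow> \<exists>V. E_valuation V \<and> bool_eval V \<mu>"
    and xs: "xs \<in> set (subseqs (minterm_list v d))"
    and ys: "ys \<in> set (subseqs (minterm_list v d))"
    and equiv: "disj_list xs \<approx> disj_list ys"
  shows "xs = ys"
proof -
  have sub: "set xs \<subseteq> set ys"
    if "xs \<in> set (subseqs (minterm_list v d))" "ys \<in> set (subseqs (minterm_list v d))"
      and equiv: "disj_list xs \<approx> disj_list ys" for xs ys
  proof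
    fix \<mu> assume \<mu>: "\<mu> \<in> set xs"
    then have "\<mu> \<in> minterms v d"
      using that(1) subseqs_minterm_subset by blast
    then obtain V where V: "E_valuation V" "bool_eval V \<mu>"
      using sat by blast
    then obtain \<nu> where \<nu>: "\<nu> \<in> set ys" "bool_eval V \<nu>"
      using \<mu> equiv by (auto simp: equiv_E_iff)
    then have "\<nu> \<in> minterms v d"
      using that(2) subseqs_minterm_subset by blast
    then show "\<mu> \<in> set ys"
      using satisfied_minterm_unique \<open>\<mu> \<in> minterms v d\<close> V(2) \<nu> by blast
  qed
  have "set xs = set ys"
    using sub xs ys equiv equiv_E_sym by blast
  \<comment> \<open>For a list without repetitions, \<open>set\<close> is injective on
    subsequences.\<close>
  then show ?thesis
    using distinct_set_subseqs[OF distinct_minterm_list[of v d]] xs ys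
    by (auto simp: distinct_map dest: inj_onD)
qed

lemma dcf_equiv_imp_eq:
  assumes "\<And>\<mu>. \<mu> \<in> minterms v d \<Longrightarrow> \<exists>V. E_valuation V \<and> bool_eval V \<mu>"
    and "\<phi> \<in> set (dcf_list v d)" "\<psi> \<in> set (dcf_list v d)" "\<phi> \<approx> \<psi>"
  shows "\<phi> = \<psi>"
  using assms(2-) equivalent_disjunctions_eq[OF assms(1)] by (auto simp: set_dcf_list)

lemma distinct_dcf_list:
  assumes "\<And>\<mu>. \<mu> \<in> minterms v d \<Longrightarrow> \<exists>V. E_valuation V \<and> bool_eval V \<mu>"
  shows "distinct (dcf_list v d)"
proof -
  have "inj_on disj_list (set (subseqs (minterm_list v d)))"
    using equivalent_disjunctions_eq[OF assms] by (intro inj_onI) (metis equiv_E_refl)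
  then show ?thesis
    using distinct_set_subseqs[OF distinct_minterm_list[of v d]]
    by (simp add: set_disjs_def distinct_map)
qed

text \<open>Every choice of signs is consistent: distinct DCF formulas of the previous level are
  inequivalent, so values prescribed on their diamonds cannot conflict with \<approx>.\<close>

lemma minterm_satisfiable: "\<mu> \<in> minterms v d \<Longrightarrow> \<exists>V. E_valuation V \<and> bool_eval V \<mu>"
proof (induction d arbitrary: \<mu>)
  case 0
  have "distinct (map Var [0..<v])"
    by (simp add: distinct_map inj_on_def)
  then obtain P where "\<mu> = conj_list (map (literal P) (map Var [0..<v]))"
    using 0 by (auto simp: minterms_0 elim!: signed_conjs_distinct_literals)
  \<comment> \<open>The empty set makes every diamond false; a level-0 minterm constrains the
    variables alone.\<close>
  then have "bool_eval (E_extension {} P) \<mu>" by simp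
  then show ?case using E_valuation_extension by blast
next
  case (Suc d)
  obtain \<mu>' \<chi> where \<mu>: "\<mu> = And \<mu>' \<chi>" "\<mu>' \<in> minterms v 0"
    "\<chi> \<in> set (signed_conjs (map Dia (dcf_list v d)))"
    using Suc.prems by (auto simp: minterms_Suc)
  have "distinct (map Var [0..<v])"
    by (simp add: distinct_map inj_on_def)
  then obtain P where P: "\<mu>' = conj_list (map (literal P) (map Var [0..<v]))"
    using \<mu>(2) by (auto simp: minterms_0 elim!: signed_conjs_distinct_literals)
  have "distinct (map Dia (dcf_list v d))"
    using distinct_dcf_list[OF Suc.IH] by (simp add: distinct_map inj_on_def)
  then obtain Q where Q: "\<chi> = conj_list (map (literal Q) (map Dia (dcf_list v d)))"
    using \<mu>(3) by (auto elim!: signed_conjs_distinct_literals)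
  define V where "V = E_extension (set (dcf_list v d))
    (\<lambda>\<phi>. case \<phi> of Dia \<alpha> \<Rightarrow> Q \<phi> | _ \<Rightarrow> P \<phi>)"
  \<comment> \<open>Among the DCF formulas only \<phi> itself is equivalent to \<phi>, so the
    extension takes the value of \<open>Q\<close> there.\<close>
  have "V (Dia \<phi>) = Q (Dia \<phi>)" if "\<phi> \<in> set (dcf_list v d)" for \<phi>
    using that dcf_equiv_imp_eq[OF Suc.IH] equiv_E_refl
    unfolding V_def E_extension_simps fm.case by metis
  moreover have "V (Var i) = P (Var i)" for i
    by (simp add: V_def)
  ultimately have "bool_eval V \<mu>"
    by (auto simp: \<mu>(1) P Q)
  then show ?case
    using E_valuation_extension V_def by blast
qed

text \<open>The disjunction consists of the minterms compatible with \<phi>. The hypothesis is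
  semantic, rather than membership in \<open>formulas v d\<close>, because this is what the
  induction in \<open>minterm_decides\<close> supplies.\<close>

lemma formula_equiv_dcf:
  assumes agree: "\<And>V W \<mu>. E_valuation V \<Longrightarrow> E_valuation W \<Longrightarrow> \<mu> \<in> minterms v d \<Longrightarrow>
      bool_eval V \<mu> \<Longrightarrow> bool_eval W \<mu> \<Longrightarrow> bool_eval V \<phi> = bool_eval W \<phi>"
  obtains \<psi> where "\<psi> \<in> set (dcf_list v d)" "\<phi> \<approx> \<psi>"
proof -
  let ?M = "{\<mu> \<in> minterms v d. \<exists>V. E_valuation V \<and> bool_eval V \<mu> \<and> bool_eval V \<phi>}"
  have "?M \<in> set ` set (subseqs (minterm_list v d))"
    unfolding subseqs_powset by (auto simp: minterms_def)
  then obtain xs where xs: "xs \<in> set (subseqs (minterm_list v d))" "set xs = ?M"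
    by auto
  have "bool_eval V \<phi> \<longleftrightarrow> (\<exists>\<mu>\<in>?M. bool_eval V \<mu>)" if V: "E_valuation V" for V
  proof
    assume "bool_eval V \<phi>"
    then show "\<exists>\<mu>\<in>?M. bool_eval V \<mu>"
      using V ex_minterm_satisfied[of v d V] by blast
  next
    assume "\<exists>\<mu>\<in>?M. bool_eval V \<mu>"
    then show "bool_eval V \<phi>"
      using V agree by blast
  qed
  then have "\<phi> \<approx> disj_list xs"
    using xs(2) by (simp add: equiv_E_iff)
  then show thesis
    using that xs(1) by (auto simp: set_dcf_list)
qed

text \<open>For \<psi> of the previous level, \<open>Dia \<psi>\<close> has the value of the diamond
  of an equivalent DCF formula, and the sign of that modal factor is fixed by \<mu>.\<close>

lemma minterm_decides:
  assumes "\<phi> \<in> formulas v d" "\<mu> \<in> minterms v d" "E_valuation V" "E_valuation W"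
    "bool_eval V \<mu>" "bool_eval W \<mu>"
  shows "bool_eval V \<phi> = bool_eval W \<phi>"
  using assms
proof (induction d arbitrary: \<phi> \<mu> V W)
  case 0
  have "V (Var i) = W (Var i)" if "i < v" for i
    using signed_conjs_agree[of \<mu> "map Var [0..<v]" V W "Var i"] 0 that by (auto simp: minterms_0)
  then show ?case
    using \<open>\<phi> \<in> formulas v 0\<close> by (induction \<phi>) (auto simp: formulas_def)
next
  case (Suc d)
  obtain \<mu>' \<chi> where \<mu>: "\<mu> = And \<mu>' \<chi>" "\<mu>' \<in> minterms v 0"
    "\<chi> \<in> set (signed_conjs (map Dia (dcf_list v d)))"
    using Suc.prems by (auto simp: minterms_Suc)
  have var: "V (Var i) = W (Var i)" if "i < v" for i
    using signed_conjs_agree[of \<mu>' "map Var [0..<v]" V W "Var i"] Suc.prems \<mu> that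
    by (auto simp: minterms_0)
  have dcf: "V (Dia \<psi>) = W (Dia \<psi>)" if "\<psi> \<in> set (dcf_list v d)" for \<psi>
    using signed_conjs_agree[OF \<mu>(3), of V W "Dia \<psi>"] Suc.prems \<mu> that by auto
  have dia: "V (Dia \<psi>) = W (Dia \<psi>)" if "\<psi> \<in> formulas v d" for \<psi>
  proof -
    obtain \<psi>' where "\<psi>' \<in> set (dcf_list v d)" "\<psi> \<approx> \<psi>'"
      by (rule formula_equiv_dcf[of v d \<psi>]) (rule Suc.IH[OF \<open>\<psi> \<in> formulas v d\<close>])
    then show ?thesis
      using dcf Suc.prems(3,4) by (auto simp: E_valuation_def)
  qed
  show ?case
    using \<open>\<phi> \<in> formulas v (Suc d)\<close> var dia by (induction \<phi>) (auto simp: formulas_def)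
qed

lemma equivalent_minterms_eq:
  assumes "\<mu> \<in> minterms v d" "\<nu> \<in> minterms v d" "\<mu> \<approx> \<nu>"
  shows "\<mu> = \<nu>"
  using assms minterm_satisfiable satisfied_minterm_unique by (metis equiv_E_iff)

lemma minterm_of_eq:
  assumes "\<nu> \<in> minterms v d" "\<phi> \<approx> \<nu>"
  shows "minterm_of v d \<phi> = \<nu>"
  unfolding minterm_of_def
  using assms equivalent_minterms_eq equiv_E_sym equiv_E_trans by (blast intro: the_equality)

section \<open>Invertible endomorphisms\<close>

text \<open>This represents an endomorphism of the Boolean algebra of formulas modulo \<approx>: the
  first clause expresses compatibility with the connectives through a pulled-back valuation, the
  second well-definedness on classes.\<close>

definition E_hom :: "(fm \<Rightarrow> fm) \<Rightarrow> bool" where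
  "E_hom h \<longleftrightarrow> (\<forall>V \<phi>. bool_eval V (h \<phi>) = bool_eval (\<lambda>\<alpha>. bool_eval V (h \<alpha>)) \<phi>) \<and>
     (\<forall>\<phi> \<psi>. \<phi> \<approx> \<psi> \<longrightarrow> h \<phi> \<approx> h \<psi>)"

lemma E_hom_equiv: "E_hom h \<Longrightarrow> \<phi> \<approx> \<psi> \<Longrightarrow> h \<phi> \<approx> h \<psi>"
  by (simp add: E_hom_def)

lemma E_hom_eval: "E_hom h \<Longrightarrow> bool_eval V (h \<phi>) = bool_eval (\<lambda>\<alpha>. bool_eval V (h \<alpha>)) \<phi>"
  unfolding E_hom_def by blast

lemma E_hom_valuation:
  assumes "E_hom h" "E_valuation V"
  shows "E_valuation (\<lambda>\<alpha>. bool_eval V (h \<alpha>))"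
proof -
  have "bool_eval V (h (Dia \<phi>)) = bool_eval V (h (Dia \<psi>))" if "\<phi> \<approx> \<psi>" for \<phi> \<psi>
    using E_hom_equiv[OF assms(1) equiv_E_Dia[OF that]] assms(2) by (simp add: equiv_E_iff)
  then show ?thesis
    unfolding E_valuation_def by blast
qed

lemma E_hom_id: "E_hom (\<lambda>\<phi>. \<phi>)"
proof -
  have "bool_eval V \<phi> = bool_eval (bool_eval V) \<phi>" for V \<phi>
    by (rule bool_eval_cong) auto
  then show ?thesis unfolding E_hom_def by blast
qed

lemma E_hom_compose:
  assumes "E_hom g" "E_hom h"
  shows "E_hom (\<lambda>\<phi>. g (h \<phi>))"
proof -
  have "bool_eval V (g (h \<phi>)) = bool_eval (\<lambda>\<alpha>. bool_eval V (g (h \<alpha>))) \<phi>" for V \<phi>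
  proof -
    let ?W = "\<lambda>\<alpha>. bool_eval V (g \<alpha>)"
    have "bool_eval V (g (h \<phi>)) = bool_eval (\<lambda>\<alpha>. bool_eval ?W (h \<alpha>)) \<phi>"
      using E_hom_eval[OF assms(1), of V "h \<phi>"] E_hom_eval[OF assms(2), of ?W \<phi>] by simp
    moreover have "(\<lambda>\<alpha>. bool_eval ?W (h \<alpha>)) = (\<lambda>\<alpha>. bool_eval V (g (h \<alpha>)))"
      by (rule ext) (rule E_hom_eval[OF assms(1), symmetric])
    ultimately show ?thesis by simp
  qed
  then show ?thesis
    using assms unfolding E_hom_def by blast
qed

lemma E_hom_funpow: "E_hom h \<Longrightarrow> E_hom (h ^^ n)"
proof (induction n)
  case 0
  then show ?case using E_hom_id by (simp add: id_def)
next
  case (Suc n)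
  then show ?case using E_hom_compose[of h "h ^^ n"] by (simp add: comp_def)
qed

text \<open>The inverse laws are restricted to \<open>formulas v d\<close> and hold up to \<approx>,
  to cover prime substitutions, which are invertible in this sense on the first \<open>v\<close>
  variables.\<close>

locale E_automorphism =
  fixes v d :: nat and h h' :: "fm \<Rightarrow> fm"
  assumes hom: "E_hom h" "E_hom h'"
    and closed: "\<And>\<phi>. \<phi> \<in> formulas v d \<Longrightarrow> h \<phi> \<in> formulas v d"
      "\<And>\<phi>. \<phi> \<in> formulas v d \<Longrightarrow> h' \<phi> \<in> formulas v d"
    and inverse: "\<And>\<phi>. \<phi> \<in> formulas v d \<Longrightarrow> h' (h \<phi>) \<approx> \<phi>"
      "\<And>\<phi>. \<phi> \<in> formulas v d \<Longrightarrow> h (h' \<phi>) \<approx> \<phi>"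
begin

text \<open>An E-valuation satisfying \<mu>, pulled back along \<open>h'\<close>, satisfies
  \<open>h \<mu>\<close> and some minterm \<nu>. These are equivalent because \<nu> decides
  \<open>h \<mu>\<close> and \<mu> decides \<open>h' \<nu>\<close>.\<close>

lemma image_equiv_minterm:
  assumes \<mu>: "\<mu> \<in> minterms v d"
  shows "\<exists>\<nu>\<in>minterms v d. h \<mu> \<approx> \<nu>"
proof -
  obtain V where V: "E_valuation V" "bool_eval V \<mu>"
    using minterm_satisfiable[OF \<mu>] by blast
  let ?V = "\<lambda>\<alpha>. bool_eval V (h' \<alpha>)"
  obtain \<nu> where \<nu>: "\<nu> \<in> minterms v d" "bool_eval ?V \<nu>"
    using ex_minterm_satisfied by blast
  have form: "\<mu> \<in> formulas v d" "\<nu> \<in> formulas v d"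
    using \<mu> \<nu>(1) minterms_subset_formulas by auto
  have "bool_eval V (h' (h \<mu>))"
    using V inverse(1)[OF form(1)] by (simp add: equiv_E_iff)
  then have V_h\<mu>: "bool_eval ?V (h \<mu>)"
    using E_hom_eval[OF hom(2)] by blast
  have V_h'\<nu>: "bool_eval V (h' \<nu>)"
    using \<nu>(2) E_hom_eval[OF hom(2)] by blast
  have "bool_eval W (h \<mu>) = bool_eval W \<nu>" if W: "E_valuation W" for W
  proof
    assume "bool_eval W \<nu>"
    then show "bool_eval W (h \<mu>)"
      using V_h\<mu> minterm_decides[OF closed(1)[OF form(1)] \<nu>(1) E_hom_valuation[OF hom(2) V(1)] W]
        \<nu>(2) by blast
  next
    let ?W = "\<lambda>\<alpha>. bool_eval W (h \<alpha>)"
    assume "bool_eval W (h \<mu>)"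
    then have "bool_eval ?W \<mu>"
      using E_hom_eval[OF hom(1)] by blast
    then have "bool_eval ?W (h' \<nu>)"
      using V_h'\<nu> V minterm_decides[OF closed(2)[OF form(2)] \<mu> V(1) E_hom_valuation[OF hom(1) W]]
      by blast
    then have "bool_eval W (h (h' \<nu>))"
      using E_hom_eval[OF hom(1)] by blast
    then show "bool_eval W \<nu>"
      using W inverse(2)[OF form(2)] by (simp add: equiv_E_iff)
  qed
  then show ?thesis
    using \<nu>(1) by (auto simp: equiv_E_iff)
qed

lemma image_equiv_unique_minterm:
  assumes "\<mu> \<in> minterms v d"
  shows "\<exists>!\<nu>. \<nu> \<in> minterms v d \<and> h \<mu> \<approx> \<nu>"
  using image_equiv_minterm[OF assms] minterm_of_eq by metis

lemma minterm_of_image: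
  assumes "\<mu> \<in> minterms v d"
  shows "minterm_of v d (h \<mu>) \<in> minterms v d" "h \<mu> \<approx> minterm_of v d (h \<mu>)"
  using image_equiv_minterm[OF assms] minterm_of_eq by metis+

lemma swap: "E_automorphism v d h' h"
  using hom closed inverse by unfold_locales

lemma minterm_of_inverse:
  assumes "\<mu> \<in> minterms v d"
  shows "minterm_of v d (h' (minterm_of v d (h \<mu>))) = \<mu>"
proof (rule minterm_of_eq[OF assms])
  have "h' (minterm_of v d (h \<mu>)) \<approx> h' (h \<mu>)"
    using minterm_of_image(2)[OF assms] E_hom_equiv[OF hom(2)] equiv_E_sym by blast
  then show "h' (minterm_of v d (h \<mu>)) \<approx> \<mu>"
    using inverse(1) assms minterms_subset_formulas equiv_E_trans by blast
qed

lemma bij_betw_minterms: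
  "bij_betw (\<lambda>\<mu>. minterm_of v d (h \<mu>)) (minterms v d) (minterms v d)"
  using minterm_of_inverse E_automorphism.minterm_of_inverse[OF swap]
    minterm_of_image(1) E_automorphism.minterm_of_image(1)[OF swap]
  by (intro bij_betw_byWitness[where f' = "\<lambda>\<mu>. minterm_of v d (h' \<mu>)"]) auto

end

text \<open>Both sides are the minterm equivalent to the common formula
  \<open>g (h \<mu>)\<close>.\<close>

lemma minterm_of_commute:
  assumes "E_automorphism v d g g'" "E_automorphism v d h h'" "\<mu> \<in> minterms v d"
    and comm: "g (h \<mu>) = h (g \<mu>)"
  shows "minterm_of v d (g (minterm_of v d (h \<mu>))) = minterm_of v d (h (minterm_of v d (g \<mu>)))"
proof -
  interpret g: E_automorphism v d g g' by fact
  interpret h: E_automorphism v d h h' by fact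
  have "g (minterm_of v d (h \<mu>)) \<approx> g (h \<mu>)"
    using h.minterm_of_image(2)[OF assms(3)] E_hom_equiv[OF g.hom(1)] equiv_E_sym by blast
  moreover have "h (g \<mu>) \<approx> h (minterm_of v d (g \<mu>))"
    using g.minterm_of_image(2)[OF assms(3)] E_hom_equiv[OF h.hom(1)] by blast
  ultimately have "g (minterm_of v d (h \<mu>)) \<approx> h (minterm_of v d (g \<mu>))"
    unfolding comm by (rule equiv_E_trans)
  then show ?thesis
    using minterm_of_eq equiv_E_trans h.minterm_of_image g.minterm_of_image assms(3) by metis
qed

section \<open>Prime substitutions\<close>

lemma E_hom_subst: "E_hom (fm_subst \<sigma>)"
  unfolding E_hom_def using bool_eval_subst equiv_E_subst by blast

lemma fm_subst_fm_subst: "fm_subst \<tau> (fm_subst \<sigma> \<phi>) = fm_subst (\<lambda>i. fm_subst \<tau> (\<sigma> i)) \<phi>"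
  by (induction \<phi>) auto

lemma fm_subst_Var [simp]: "fm_subst Var \<phi> = \<phi>"
  by (induction \<phi>) auto

lemma fm_subst_formulas:
  "\<sigma> \<in> level0_substs v \<Longrightarrow> \<phi> \<in> formulas v d \<Longrightarrow> fm_subst \<sigma> \<phi> \<in> formulas v d"
proof (induction \<phi> arbitrary: d)
  case (Dia \<phi>)
  then show ?case by (cases d) (auto simp: formulas_def)
qed (auto simp: formulas_def level0_substs_def)

lemma prime_subst_automorphism:
  assumes "\<sigma> \<in> prime_substs v"
  obtains \<sigma>' where "E_automorphism v d (fm_subst \<sigma>) (fm_subst \<sigma>')"
proof -
  obtain \<sigma>' where \<sigma>: "\<sigma> \<in> level0_substs v" "\<sigma>' \<in> level0_substs v"
    "subst_equiv v (subst_comp \<sigma> \<sigma>') Var" "subst_equiv v (subst_comp \<sigma>' \<sigma>) Var"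
    using assms by (auto simp: prime_substs_def)
  \<comment> \<open>The composite agrees with \<open>Var\<close> up to \<approx> on the first
    \<open>v\<close> variables, and congruence extends this to all formulas in them. Both orders of
    composition are instances.\<close>
  have inv: "fm_subst \<tau>' (fm_subst \<tau> \<phi>) \<approx> \<phi>"
    if "subst_equiv v (subst_comp \<tau> \<tau>') Var" "\<phi> \<in> formulas v d" for \<tau> \<tau>' \<phi>
    using that fm_subst_cong_equiv_E[of \<phi> "\<lambda>i. fm_subst \<tau>' (\<tau> i)" Var]
    by (auto simp: fm_subst_fm_subst subst_equiv_def subst_comp_def formulas_def)
  have "E_automorphism v d (fm_subst \<sigma>) (fm_subst \<sigma>')"
    by unfold_locales (use \<sigma> in \<open>auto intro: E_hom_subst fm_subst_formulas inv\<close>)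
  then show thesis by (rule that)
qed

section \<open>Uniform replacements\<close>

lemma bool_eval_replace:
  "bool_eval V (\<phi> \<star> \<rho>) = bool_eval (\<lambda>\<alpha>. bool_eval V (\<alpha> \<star> \<rho>)) \<phi>"
  by (induction \<phi>) auto

lemma replace_subst: "fm_subst \<sigma> \<phi> \<star> \<rho> = fm_subst (\<lambda>i. \<sigma> i \<star> \<rho>) (\<phi> \<star> \<rho>)"
  by (induction \<phi>) (auto simp: fm_subst_fm_subst)

text \<open>Tautologies survive because replacement commutes with the connectives, \<open>US\<close>
  because replacement can be applied to the substituted formulas as well, and \<open>RE\<close>
  because equivalent arguments substituted into \<rho> give equivalent results.\<close>

lemma logic_E_replace: "logic_E \<phi> \<Longrightarrow> logic_E (\<phi> \<star> \<rho>)"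
proof (induction rule: logic_E.induct)
  case (Taut \<phi>)
  have "bool_eval V (\<phi> \<star> \<rho>)" for V
    using Taut bool_eval_replace[of V \<phi> \<rho>] by (simp add: tautology_def)
  then show ?case
    by (simp add: logic_E.Taut tautology_def)
next
  case (MP \<phi> \<psi>)
  then show ?case using logic_E.MP[of "\<phi> \<star> \<rho>" "\<psi> \<star> \<rho>"] by simp
next
  case (US \<phi> \<sigma>)
  then show ?case by (simp add: replace_subst logic_E.US)
next
  case (RE \<phi> \<psi>)
  then have "\<phi> \<star> \<rho> \<approx> \<psi> \<star> \<rho>"
    by (simp add: equiv_E_def)
  then have "fm_subst (\<lambda>_. \<phi> \<star> \<rho>) \<rho> \<approx> fm_subst (\<lambda>_. \<psi> \<star> \<rho>) \<rho>"
    by (rule fm_subst_cong_equiv_E)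
  then show ?case by (simp add: equiv_E_def)
qed

lemma E_hom_replace: "E_hom (\<lambda>\<phi>. \<phi> \<star> \<rho>)"
  unfolding E_hom_def
proof (intro conjI allI impI)
  show "\<phi> \<star> \<rho> \<approx> \<psi> \<star> \<rho>" if "\<phi> \<approx> \<psi>" for \<phi> \<psi>
    using that logic_E_replace[of "Iff \<phi> \<psi>" \<rho>] by (simp add: equiv_E_def)
qed (rule bool_eval_replace)

lemma replace_depth_0: "fm_depth \<phi> = 0 \<Longrightarrow> \<phi> \<star> \<rho> = \<phi>"
  by (induction \<phi>) auto

text \<open>Replacement leaves the non-modal values of \<sigma> unchanged. The equality is
  syntactic, as \<open>minterm_of_commute\<close> requires.\<close>

lemma replace_level0_subst:
  assumes "\<sigma> \<in> level0_substs v" "fm_vars \<phi> \<subseteq> {..<v}"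
  shows "fm_subst \<sigma> \<phi> \<star> \<rho> = fm_subst \<sigma> (\<phi> \<star> \<rho>)"
  using assms(2)
proof (induction \<phi>)
  case (Var i)
  then show ?case
    using assms(1) by (auto simp: level0_substs_def formulas_def intro: replace_depth_0)
qed (auto simp: fm_subst_fm_subst)

lemma fm_vars_const_subst: "fm_vars (fm_subst (\<lambda>_. \<chi>) \<phi>) \<subseteq> fm_vars \<chi>"
  by (induction \<phi>) auto

lemma fm_depth_const_subst: "fm_depth (fm_subst (\<lambda>_. \<chi>) \<phi>) \<le> fm_depth \<phi> + fm_depth \<chi>"
  by (induction \<phi>) auto

lemma fm_depth_replace: "fm_depth \<rho> \<le> 1 \<Longrightarrow> fm_depth (\<phi> \<star> \<rho>) \<le> fm_depth \<phi>"
proof (induction \<phi>)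
  case (Dia \<phi>)
  then show ?case using fm_depth_const_subst[of "\<phi> \<star> \<rho>" \<rho>] by simp
qed auto

lemma fm_vars_replace: "fm_vars (\<phi> \<star> \<rho>) \<subseteq> fm_vars \<phi>"
proof (induction \<phi>)
  case (Dia \<phi>)
  then show ?case using fm_vars_const_subst[of "\<phi> \<star> \<rho>" \<rho>] by auto
qed auto

lemma replace_formulas: "fm_depth \<rho> \<le> 1 \<Longrightarrow> \<phi> \<in> formulas v d \<Longrightarrow> \<phi> \<star> \<rho> \<in> formulas v d"
  using fm_depth_replace[of \<rho> \<phi>] fm_vars_replace[of \<phi> \<rho>] by (auto simp: formulas_def)

section \<open>Iterated replacement and its truth tables\<close>

lemma funpow_replace_Boolean:
  "((\<lambda>\<phi>. \<phi> \<star> \<rho>) ^^ n) (Var i) = Var i"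
  "((\<lambda>\<phi>. \<phi> \<star> \<rho>) ^^ n) Bot = Bot"
  "((\<lambda>\<phi>. \<phi> \<star> \<rho>) ^^ n) Top = Top"
  "((\<lambda>\<phi>. \<phi> \<star> \<rho>) ^^ n) (Neg \<phi>) = Neg (((\<lambda>\<phi>. \<phi> \<star> \<rho>) ^^ n) \<phi>)"
  "((\<lambda>\<phi>. \<phi> \<star> \<rho>) ^^ n) (Or \<phi> \<psi>) = Or (((\<lambda>\<phi>. \<phi> \<star> \<rho>) ^^ n) \<phi>) (((\<lambda>\<phi>. \<phi> \<star> \<rho>) ^^ n) \<psi>)"
  "((\<lambda>\<phi>. \<phi> \<star> \<rho>) ^^ n) (And \<phi> \<psi>) = And (((\<lambda>\<phi>. \<phi> \<star> \<rho>) ^^ n) \<phi>) (((\<lambda>\<phi>. \<phi> \<star> \<rho>) ^^ n) \<psi>)"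
  by (induction n) auto

text \<open>\<open>Dia (Var 0)\<close> serves as the generic diamond: its iterate is the
  \<open>n\<close>-fold composite of \<rho>, so iterates need to be computed for one variable
  only.\<close>

lemma funpow_replace_Dia:
  "((\<lambda>\<phi>. \<phi> \<star> \<rho>) ^^ n) (Dia \<psi>) =
    fm_subst (\<lambda>_. ((\<lambda>\<phi>. \<phi> \<star> \<rho>) ^^ n) \<psi>) (((\<lambda>\<phi>. \<phi> \<star> \<rho>) ^^ n) (Dia (Var 0)))"
proof (induction n)
  case (Suc n)
  then show ?case by (simp add: replace_subst)
qed simp

text \<open>The value \<open>b\<close> is a catch-all: the only remaining atom of a prime
  replacement is \<open>Dia (Neg (Var 0))\<close>.\<close>

definition UR_table :: "fm \<Rightarrow> bool \<Rightarrow> bool \<Rightarrow> bool \<Rightarrow> bool" where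
  "UR_table \<rho> x a b =
     bool_eval (\<lambda>\<alpha>. if \<alpha> = Var 0 then x else if \<alpha> = Dia (Var 0) then a else b) \<rho>"

text \<open>
  The action of \<open>\<rho>\<close> on the truth values of \<open>e\<close>, \<open>Dia e\<close> and \<open>Dia (Neg e)\<close>; passing from \<open>e\<close> to
  \<open>Neg e\<close> interchanges the last two.
\<close>
definition UR_action :: "fm \<Rightarrow> bool \<times> bool \<times> bool \<Rightarrow> bool \<times> bool \<times> bool" where
  "UR_action \<rho> = (\<lambda>(x, a, b). (x, UR_table \<rho> x a b, UR_table \<rho> (\<not> x) b a))"

definition UR_state :: "(fm \<Rightarrow> bool) \<Rightarrow> bool \<times> bool \<times> bool" where
  "UR_state V = (V (Var 0), V (Dia (Var 0)), V (Dia (Neg (Var 0))))"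

lemma prime_UR_depth: "\<rho> \<in> prime_URs \<Longrightarrow> fm_depth \<rho> \<le> 1"
  by (auto simp: prime_URs_def)

lemma prime_UR_eval:
  "\<rho> \<in> prime_URs \<Longrightarrow> bool_eval V (fm_subst (\<lambda>_. \<chi>) \<rho>) =
    UR_table \<rho> (bool_eval V \<chi>) (V (Dia \<chi>)) (V (Dia (Neg \<chi>)))"
  unfolding prime_URs_def UR_table_def by auto

lemma UR_table_simps [simp]:
  "UR_table (Var 0) x a b = x"
  "UR_table (Dia (Var 0)) x a b = a"
  "UR_table (Dia (Neg (Var 0))) x a b = b"
  "UR_table Top x a b = True"
  "UR_table (Neg \<phi>) x a b = (\<not> UR_table \<phi> x a b)"
  "UR_table (Or \<phi> \<psi>) x a b = (UR_table \<phi> x a b \<or> UR_table \<psi> x a b)"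
  "UR_table (And \<phi> \<psi>) x a b = (UR_table \<phi> x a b \<and> UR_table \<psi> x a b)"
  by (simp_all add: UR_table_def)

lemma funpow_12: "(f ^^ 12) s = f (f (f (f (f (f (f (f (f (f (f (f s)))))))))))"
  by (simp add: numeral_eq_Suc)

text \<open>At fixed \<open>x\<close> the action permutes four pairs, and 12 is a common multiple of
  the cycle lengths 1 to 4. The actions at the two values of \<open>x\<close> are conjugate under
  interchange of the last two components. The proof evaluates all 24 replacements on all eight
  states.\<close>

lemma UR_action_order:
  assumes "\<rho> \<in> prime_URs"
  shows "(UR_action \<rho> ^^ 12) s = s"
proof -
  have "\<forall>x a b. (UR_action \<rho> ^^ 12) (x, a, b) = (x, a, b)"
    using assms unfolding prime_URs_def Un_iff mem_Collect_eq insert_iff empty_iff simp_thms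
      all_bool_eq
    by (elim disjE exE conjE; hypsubst; simp add: funpow_12 UR_action_def)
  then show ?thesis
    by (cases s) simp
qed

lemma UR_state_replace:
  assumes "\<rho> \<in> prime_URs" "E_valuation V"
  shows "UR_state (\<lambda>\<alpha>. bool_eval V (\<alpha> \<star> \<rho>)) = UR_action \<rho> (UR_state V)"
proof -
  \<comment> \<open>Replacement in \<open>Dia (Neg e)\<close> evaluates \<rho> at
    \<open>Neg e\<close>, which brings in the diamond of a double negation.\<close>
  have "Neg (Neg (Var 0)) \<approx> Var 0"
    by (simp add: equiv_E_iff)
  then have "V (Dia (Neg (Neg (Var 0)))) = V (Dia (Var 0))"
    using assms(2) by (auto simp: E_valuation_def)
  then show ?thesis
    by (simp add: UR_state_def UR_action_def prime_UR_eval[OF assms(1)])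
qed

lemma UR_state_funpow_replace:
  assumes "\<rho> \<in> prime_URs" "E_valuation V"
  shows "UR_state (\<lambda>\<alpha>. bool_eval V (((\<lambda>\<phi>. \<phi> \<star> \<rho>) ^^ n) \<alpha>)) = (UR_action \<rho> ^^ n) (UR_state V)"
  using assms(2)
proof (induction n arbitrary: V)
  case 0
  then show ?case by (simp add: UR_state_def)
next
  case (Suc n)
  \<comment> \<open>The outermost replacement is absorbed into the valuation, to which the induction
    hypothesis then applies.\<close>
  let ?W = "\<lambda>\<alpha>. bool_eval V (\<alpha> \<star> \<rho>)"
  have W: "E_valuation ?W"
    by (rule E_hom_valuation[OF E_hom_replace Suc.prems])
  have "(\<lambda>\<alpha>. bool_eval V (((\<lambda>\<phi>. \<phi> \<star> \<rho>) ^^ Suc n) \<alpha>)) =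
      (\<lambda>\<alpha>. bool_eval ?W (((\<lambda>\<phi>. \<phi> \<star> \<rho>) ^^ n) \<alpha>))"
    by (rule ext) (simp, rule bool_eval_replace)
  then have "UR_state (\<lambda>\<alpha>. bool_eval V (((\<lambda>\<phi>. \<phi> \<star> \<rho>) ^^ Suc n) \<alpha>)) =
      (UR_action \<rho> ^^ n) (UR_state ?W)"
    using Suc.IH[OF W] by simp
  then show ?case
    using UR_state_replace[OF assms(1) Suc.prems] by (simp add: funpow_swap1)
qed

lemma funpow_replace_equiv:
  assumes "\<rho> \<in> prime_URs"
  shows "((\<lambda>\<phi>. \<phi> \<star> \<rho>) ^^ 12) \<phi> \<approx> \<phi>"
proof (induction \<phi>)
  case (Dia \<psi>)
  let ?h = "(\<lambda>\<phi>. \<phi> \<star> \<rho>) ^^ 12"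
  \<comment> \<open>The value of \<open>Dia (Var 0)\<close> is the second component of the state,
    which the twelfth power of the action restores.\<close>
  have "?h (Dia (Var 0)) \<approx> Dia (Var 0)"
    using UR_state_funpow_replace[OF assms, of _ 12] UR_action_order[OF assms]
    by (auto simp: equiv_E_iff UR_state_def)
  then have "fm_subst (\<lambda>_. \<psi>) (?h (Dia (Var 0))) \<approx> Dia \<psi>"
    using equiv_E_subst[of _ "Dia (Var 0)" "\<lambda>_. \<psi>"] by simp
  moreover have "?h (Dia \<psi>) \<approx> fm_subst (\<lambda>_. \<psi>) (?h (Dia (Var 0)))"
    unfolding funpow_replace_Dia[of 12 \<rho> \<psi>] by (rule fm_subst_cong_equiv_E) (rule Dia)
  ultimately show ?case
    using equiv_E_trans by blast
qed (simp_all add: funpow_replace_Boolean equiv_E_iff)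

text \<open>The eleventh iterate is an inverse because one further replacement, on either side,
  completes the twelfth.\<close>

lemma prime_UR_automorphism:
  assumes "\<rho> \<in> prime_URs"
  shows "E_automorphism v d (\<lambda>\<phi>. \<phi> \<star> \<rho>) ((\<lambda>\<phi>. \<phi> \<star> \<rho>) ^^ 11)"
proof
  let ?h = "\<lambda>\<phi>. \<phi> \<star> \<rho>"
  show "E_hom ?h" "E_hom (?h ^^ 11)"
    by (simp_all add: E_hom_replace E_hom_funpow)
  show closed: "?h \<phi> \<in> formulas v d" if "\<phi> \<in> formulas v d" for \<phi>
    using that replace_formulas[OF prime_UR_depth[OF assms]] by blast
  have "(?h ^^ n) \<phi> \<in> formulas v d" if "\<phi> \<in> formulas v d" for n \<phi>
    using that by (induction n) (auto intro: closed)
  then show "(?h ^^ 11) \<phi> \<in> formulas v d" if "\<phi> \<in> formulas v d" for \<phi>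
    using that by blast
  have "?h ((?h ^^ 11) \<phi>) = (?h ^^ 12) \<phi>" for \<phi>
    using fun_cong[OF funpow.simps(2)[of 11 ?h], of \<phi>] by simp
  then show *: "?h ((?h ^^ 11) \<phi>) \<approx> \<phi>" for \<phi>
    using funpow_replace_equiv[OF assms] by simp
  show "(?h ^^ 11) (?h \<phi>) \<approx> \<phi>" for \<phi>
    using * unfolding funpow_swap1[of ?h 11] .
qed

section \<open>The induced permutations of minterms and prime orbits\<close>

theorem theorem12:
  fixes \<rho> :: fm and v d :: nat
  assumes "\<rho> \<in> prime_URs"
  shows "(\<forall>\<mu>\<in>minterms v d. \<exists>!\<nu>. \<nu> \<in> minterms v d \<and> \<mu> \<star> \<rho> \<approx> \<nu>)
       \<and> bij_betw (minterm_map v d \<rho>) (minterms v d) (minterms v d)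
       \<and> (\<forall>\<omega>\<in>prime_orbits v d. orbit_map v d \<rho> \<omega> \<in> prime_orbits v d)
       \<and> bij_betw (orbit_map v d \<rho>) (prime_orbits v d) (prime_orbits v d)"
proof -
  let ?f = "minterm_map v d \<rho>" and ?M = "minterms v d"
  note auto_\<rho> = prime_UR_automorphism[OF assms, of v d]
  interpret \<rho>: E_automorphism v d "\<lambda>\<phi>. \<phi> \<star> \<rho>" "(\<lambda>\<phi>. \<phi> \<star> \<rho>) ^^ 11"
    by (rule auto_\<rho>)
  have bij: "bij_betw ?f ?M ?M"
    using \<rho>.bij_betw_minterms by (simp add: minterm_map_def[abs_def])
  have commute: "?f (minterm_of v d (fm_subst \<sigma> \<mu>)) = minterm_of v d (fm_subst \<sigma> (?f \<mu>))"
    if \<sigma>: "\<sigma> \<in> prime_substs v" and \<mu>: "\<mu> \<in> ?M" for \<sigma> \<mu>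
  proof -
    obtain \<sigma>' where "E_automorphism v d (fm_subst \<sigma>) (fm_subst \<sigma>')"
      by (rule prime_subst_automorphism[OF \<sigma>])
    moreover have "fm_subst \<sigma> \<mu> \<star> \<rho> = fm_subst \<sigma> (\<mu> \<star> \<rho>)"
      using \<sigma> \<mu> minterms_subset_formulas
      by (intro replace_level0_subst) (auto simp: prime_substs_def formulas_def)
    ultimately show ?thesis
      unfolding minterm_map_def using minterm_of_commute[OF auto_\<rho>] \<mu> by blast
  qed
  have orbit: "orbit_map v d \<rho> (prime_orbit v d \<mu>) = prime_orbit v d (?f \<mu>)" if "\<mu> \<in> ?M" for \<mu>
    unfolding orbit_map_def prime_orbit_def image_image using commute that by (intro image_cong) auto
  have "prime_orbit v d \<mu> \<subseteq> ?M" if "\<mu> \<in> ?M" for \<mu>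
    unfolding prime_orbit_def
  proof (rule image_subsetI)
    fix \<sigma> assume "\<sigma> \<in> prime_substs v"
    then obtain \<sigma>' where "E_automorphism v d (fm_subst \<sigma>) (fm_subst \<sigma>')"
      by (rule prime_subst_automorphism)
    then show "minterm_of v d (fm_subst \<sigma> \<mu>) \<in> ?M"
      using E_automorphism.minterm_of_image(1) \<open>\<mu> \<in> ?M\<close> by blast
  qed
  then have "prime_orbits v d \<subseteq> Pow ?M"
    by (auto simp: prime_orbits_def)
  \<comment> \<open>Orbits are sets of minterms, so injectivity on orbits is inherited from the
    image map on all such sets.\<close>
  moreover have "inj_on ((`) ?f) (Pow ?M)"
    using bij by (simp add: bij_betw_def inj_on_image_Pow)
  ultimately have "inj_on (orbit_map v d \<rho>) (prime_orbits v d)"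
    unfolding orbit_map_def[abs_def] using inj_on_subset by blast
  moreover have "orbit_map v d \<rho> ` prime_orbits v d = prime_orbits v d"
  proof -
    have "orbit_map v d \<rho> ` prime_orbits v d = prime_orbit v d ` ?f ` ?M"
      unfolding prime_orbits_def image_image using orbit by (intro image_cong) auto
    \<comment> \<open>Since \<open>?f\<close> maps onto the minterms, every prime orbit is
      reached.\<close>
    then show ?thesis
      using bij by (simp add: bij_betw_def prime_orbits_def)
  qed
  ultimately show ?thesis
    using bij \<rho>.image_equiv_unique_minterm by (auto simp: bij_betw_def)
qed

end
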